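(* Let $\lambda>0$, let $\mathcal{O}$ (original) and $\mathcal{S}$ (synthetic) be two finite labelled datasets with $L_2$-regularized empirical risk objectives $P_{\mathcal{O}},P_{\mathcal{S}}$ (as defined in the context), both $\lambda$-strongly convex, with unique minimizers $\boldsymbol{\theta}_{\mathcal{O}}^*,\boldsymbol{\theta}_{\mathcal{S}}^*$. Let $\tilde{\boldsymbol{\alpha}}_{\mathcal{S}}\in\mathrm{dom}(D_{\mathcal{S}})$ be any feasible dual variable, let $G_{\mathcal{S}}(\boldsymbol{\theta}_{\mathcal{O}}^*,\tilde{\boldsymbol{\alpha}}_{\mathcal{S}}):=P_{\mathcal{S}}(\boldsymbol{\theta}_{\mathcal{O}}^* )-D_{\mathcal{S}}(\tilde{\boldsymbol{\alpha}}_{\mathcal{S}})$ be the duality gap, and let $$\Theta:=\Bigl\{\boldsymbol{\theta}:\ \|\boldsymbol{\theta}-\boldsymbol{\theta}_{\mathcal{O}}^*\|_2\le\sqrt{\tfrac{2}{\lambda}G_{\mathcal{S}}(\boldsymbol{\theta}_{\mathcal{O}}^*,\tilde{\boldsymbol{\alpha}}_{\mathcal{S}})}\Bigr\}.$$ Let $\{(\boldsymbol{x}_i',y_i')\}_{i=1}^{n'}$ be a test dataset with $\boldsymbol{x}_i'\in\mathbb{R}^d$, $y_i'\in\{-1,+1\}$, and let $$\mathrm{TeEr}=\frac1{n'}\sum_{i=1}^{n'}I\bigl[y_i'\neq\mathrm{sgn}(f(\boldsymbol{x}_i';\boldsymbol{\theta}_{\mathcal{S}}^* ))\bigr]$$ be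 the test error of the model retrained on $\mathcal{S}$. Define $$n_{\mathrm{cor}}=\sum_{i=1}^{n'}I\Bigl[\min_{\boldsymbol{\theta}\in\Theta}y_i'\boldsymbol{\theta}^\top\boldsymbol{\phi}(\boldsymbol{x}_i')>0\Bigr],\qquad n_{\mathrm{mis}}=\sum_{i=1}^{n'}I\Bigl[\max_{\boldsymbol{\theta}\in\Theta}y_i'\boldsymbol{\theta}^\top\boldsymbol{\phi}(\boldsymbol{x}_i')<0\Bigr],$$ $$n_{\mathrm{unk}}=\sum_{i=1}^{n'}I\Bigl[\min_{\boldsymbol{\theta}\in\Theta}y_i'\boldsymbol{\theta}^\top\boldsymbol{\phi}(\boldsymbol{x}_i')<0\ \text{ and }\ \max_{\boldsymbol{\theta}\in\Theta}y_i'\boldsymbol{\theta}^\top\boldsymbol{\phi}(\boldsymbol{x}_i')>0\Bigr].$$ Then $$\frac{n_{\mathrm{mis}}}{n'}\le\mathrm{TeEr}\le\frac{n_{\mathrm{mis}}+n_{\mathrm{unk}}}{n'}=\frac{n'-n_{\mathrm{cor}}}{n'},$$ where, for each $i$, $$\min_{\boldsymbol{\theta}\in\Theta}y_i'\boldsymbol{\theta}^\top\boldsymbol{\phi}(\boldsymbol{x}_i')=y_i'{\boldsymbol{\theta}_{\mathcal{O}}^*}^\top\boldsymbol{\phi}(\boldsymbol{x}_i')-\|\boldsymbol{\phi}(\boldsymbol{x}_i')\|_2\sqrt{\tfrac{2}{\lambda}G_{\mathcal{S}}(\boldsymbol{\theta}_{\mathcal{O}}^*,\tilde{\boldsymbol{\alpha}}_{\mathcal{S}})}=y_i'f(\boldsymbol{x}_i';\boldsymbol{\theta}_{\mathcal{O}}^*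 )-\sqrt{k(\boldsymbol{x}_i',\boldsymbol{x}_i')\cdot\tfrac{2}{\lambda}G_{\mathcal{S}}(\boldsymbol{\theta}_{\mathcal{O}}^*,\tilde{\boldsymbol{\alpha}}_{\mathcal{S}})},$$ $$\max_{\boldsymbol{\theta}\in\Theta}y_i'\boldsymbol{\theta}^\top\boldsymbol{\phi}(\boldsymbol{x}_i')=y_i'f(\boldsymbol{x}_i';\boldsymbol{\theta}_{\mathcal{O}}^* )+\sqrt{k(\boldsymbol{x}_i',\boldsymbol{x}_i')\cdot\tfrac{2}{\lambda}G_{\mathcal{S}}(\boldsymbol{\theta}_{\mathcal{O}}^*,\tilde{\boldsymbol{\alpha}}_{\mathcal{S}})}.$$
   Context: Let $\mathcal{H}$ be a reproducing kernel Hilbert space, $\boldsymbol{\phi}:\mathbb{R}^d\to\mathcal{H}$ a feature map, and $k(\boldsymbol{x},\boldsymbol{x}')=\boldsymbol{\phi}(\boldsymbol{x})^\top\boldsymbol{\phi}(\boldsymbol{x}')$ the kernel, where $\boldsymbol{a}^\top\boldsymbol{b}$ denotes the inner product of $\mathcal{H}$ and $\|\cdot\|_2$ its norm. The model with parameter $\boldsymbol{\theta}\in\mathcal{H}$ is $f(\boldsymbol{x};\boldsymbol{\theta})=\boldsymbol{\phi}(\boldsymbol{x})^\top\boldsymbol{\theta}$. The loss $\ell(y,t)$ is a real-valued function of a label $y$ and a real prediction $t$, convex and continuous in $t$. $I[\cdot]$ is the indicator ($1$ if the condition holds, $0$ otherwise) and $\mathrm{sgn}$ is the sign function. The original dataset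 is $\mathcal{O}=\{(\boldsymbol{x}_i^{\mathcal{O}},y_i^{\mathcal{O}})\}_{i=1}^{n_{\mathcal{O}}}$ with $\boldsymbol{x}_i^{\mathcal{O}}\in\mathbb{R}^d$, $y_i^{\mathcal{O}}\in\{-1,+1\}$; the synthetic dataset is $\mathcal{S}=\{(\boldsymbol{x}_i^{\mathcal{S}},y_i^{\mathcal{S}})\}_{i=1}^{n_{\mathcal{S}}}$ with $\boldsymbol{x}_i^{\mathcal{S}}\in\mathbb{R}^d$, $y_i^{\mathcal{S}}\in\mathbb{R}$. For $\mathcal{D}\in\{\mathcal{O},\mathcal{S}\}$ the primal objective is $$P_{\mathcal{D}}(\boldsymbol{\theta})=\sum_{i=1}^{n_{\mathcal{D}}}\ell(y_i^{\mathcal{D}},f(\boldsymbol{x}_i^{\mathcal{D}};\boldsymbol{\theta}))+\frac{\lambda}{2}\|\boldsymbol{\theta}\|_2^2 .$$ The dual objective for $\mathcal{S}$ is, for $\boldsymbol{\alpha}\in\mathbb{R}^{n_{\mathcal{S}}}$, $$D_{\mathcal{S}}(\boldsymbol{\alpha})=-\sum_{i=1}^{n_{\mathcal{S}}}\ell^*(y_i^{\mathcal{S}},-\alpha_i)-\frac{1}{2\lambda}\sum_{i=1}^{n_{\mathcal{S}}}\sum_{j=1}^{n_{\mathcal{S}}}\alpha_i\alpha_j\,y_i^{\mathcal{S}}y_j^{\mathcal{S}}\,k(\boldsymbol{x}_i^{\mathcal{S}},\boldsymbol{x}_j^{\mathcal{S}}),$$ where $\ell^*$ is the convex conjugate of $\ell$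 taken in its second argument, $\ell^*(y,s)=\sup_{t\in\mathbb{R}}\{st-\ell(y,t)\}$, and $\mathrm{dom}(D_{\mathcal{S}})=\{\boldsymbol{\alpha}:D_{\mathcal{S}}(\boldsymbol{\alpha})>-\infty\}$ is the set of feasible dual variables. Strong duality is assumed to hold: with $\boldsymbol{\alpha}_{\mathcal{S}}^*$ a maximizer of $D_{\mathcal{S}}$, $P_{\mathcal{S}}(\boldsymbol{\theta}_{\mathcal{S}}^* )=D_{\mathcal{S}}(\boldsymbol{\alpha}_{\mathcal{S}}^* )$. A convex function $F$ with nonempty domain is $\lambda$-strongly convex if for all $\boldsymbol{\theta},\boldsymbol{\theta}'\in\mathrm{dom}(F)$ and every subgradient $\boldsymbol{g}\in\partial F(\boldsymbol{\theta}')$ one has $F(\boldsymbol{\theta})-F(\boldsymbol{\theta}')\ge\boldsymbol{g}^\top(\boldsymbol{\theta}-\boldsymbol{\theta}')+\frac{\lambda}{2}\|\boldsymbol{\theta}-\boldsymbol{\theta}'\|_2^2$.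
   Formalization: The bound TeEr ≤ (n_mis+n_unk)/n' and the equality with (n'−n_cor)/n' are proved only when no test point has min or max over Θ exactly 0 (they fail e.g. if all φ(x'_i)=0); TeEr ≤ (n'−n_cor)/n' is proved always. *)

theory Defs
  imports "HOL-Analysis.Analysis"
begin

text \<open>
  The feature space is an arbitrary real Hilbert space
  \<open>'h :: {real_inner, complete_space}\<close> together with an arbitrary feature map
  \<open>\<phi> :: real ^ 'd \<Rightarrow> 'h\<close>; a reproducing kernel Hilbert space with a feature map is
  an instance. A dataset of size \<open>n\<close> is given by points \<open>x i\<close> and labels \<open>y i\<close> for
  \<open>i \<in> {1..n}\<close>. Likewise a dual vector \<open>\<alpha>\<close> with \<open>n\<close> coordinates is a function on \<open>nat\<close>
  of which only the values at \<open>1, \<dots>, n\<close> are ever used.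
\<close>

definition kernel :: "('x \<Rightarrow> 'h::real_inner) \<Rightarrow> 'x \<Rightarrow> 'x \<Rightarrow> real" where
  "kernel \<phi> x x' = \<phi> x \<bullet> \<phi> x'"

definition model :: "('x \<Rightarrow> 'h::real_inner) \<Rightarrow> 'h \<Rightarrow> 'x \<Rightarrow> real" where
  "model \<phi> \<theta> x = \<phi> x \<bullet> \<theta>"

definition primal ::
  "(real \<Rightarrow> real \<Rightarrow> real) \<Rightarrow> ('x \<Rightarrow> 'h::real_inner) \<Rightarrow> real
    \<Rightarrow> nat \<Rightarrow> (nat \<Rightarrow> 'x) \<Rightarrow> (nat \<Rightarrow> real) \<Rightarrow> 'h \<Rightarrow> real" where
  "primal loss \<phi> lam n x y \<theta> =
     (\<Sum>i=1..n. loss (y i) (model \<phi> \<theta> (x i))) + lam / 2 * (norm \<theta>)\<^sup>2"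

definition conjugate :: "(real \<Rightarrow> real \<Rightarrow> real) \<Rightarrow> real \<Rightarrow> real \<Rightarrow> ereal" where
  "conjugate loss y s = (SUP t. ereal (s * t - loss y t))"

text \<open>
  For a real-valued loss the conjugate is never \<open>-\<infinity>\<close>, so the sum below never mixes
  infinities and the dual objective takes values in the reals and \<open>-\<infinity>\<close>.
\<close>

definition dual ::
  "(real \<Rightarrow> real \<Rightarrow> real) \<Rightarrow> ('x \<Rightarrow> 'h::real_inner) \<Rightarrow> real
    \<Rightarrow> nat \<Rightarrow> (nat \<Rightarrow> 'x) \<Rightarrow> (nat \<Rightarrow> real) \<Rightarrow> (nat \<Rightarrow> real) \<Rightarrow> ereal" where
  "dual loss \<phi> lam n x y \<alpha> =
     - (\<Sum>i=1..n. conjugate loss (y i) (- \<alpha> i))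
     - ereal (1 / (2 * lam) *
         (\<Sum>i=1..n. \<Sum>j=1..n. \<alpha> i * \<alpha> j * y i * y j * kernel \<phi> (x i) (x j)))"

definition dual_dom ::
  "(real \<Rightarrow> real \<Rightarrow> real) \<Rightarrow> ('x \<Rightarrow> 'h::real_inner) \<Rightarrow> real
    \<Rightarrow> nat \<Rightarrow> (nat \<Rightarrow> 'x) \<Rightarrow> (nat \<Rightarrow> real) \<Rightarrow> (nat \<Rightarrow> real) set" where
  "dual_dom loss \<phi> lam n x y = {\<alpha>. dual loss \<phi> lam n x y \<alpha> > -\<infinity>}"

text \<open>Only meaningful for \<open>\<alpha>\<close> in \<^const>\<open>dual_dom\<close>, where the dual objective is a real number.\<close>

definition duality_gap ::
  "(real \<Rightarrow> real \<Rightarrow> real) \<Rightarrow> ('x \<Rightarrow> 'h::real_inner) \<Rightarrow> real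
    \<Rightarrow> nat \<Rightarrow> (nat \<Rightarrow> 'x) \<Rightarrow> (nat \<Rightarrow> real) \<Rightarrow> 'h \<Rightarrow> (nat \<Rightarrow> real) \<Rightarrow> real" where
  "duality_gap loss \<phi> lam n x y \<theta> \<alpha> =
     primal loss \<phi> lam n x y \<theta> - real_of_ereal (dual loss \<phi> lam n x y \<alpha>)"

definition subdifferential :: "('h::real_inner \<Rightarrow> real) \<Rightarrow> 'h \<Rightarrow> 'h set" where
  "subdifferential F \<theta>' = {g. \<forall>\<theta>. F \<theta> \<ge> F \<theta>' + g \<bullet> (\<theta> - \<theta>')}"

text \<open>The functions considered here are finite everywhere, so their domain is the whole space.\<close>

definition strongly_convex :: "real \<Rightarrow> ('h::real_inner \<Rightarrow> real) \<Rightarrow> bool" where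
  "strongly_convex lam F \<longleftrightarrow> convex_on UNIV F \<and>
     (\<forall>\<theta> \<theta>'. \<forall>g \<in> subdifferential F \<theta>'.
        F \<theta> - F \<theta>' \<ge> g \<bullet> (\<theta> - \<theta>') + lam / 2 * (norm (\<theta> - \<theta>'))\<^sup>2)"

definition unique_minimizer :: "('h \<Rightarrow> real) \<Rightarrow> 'h \<Rightarrow> bool" where
  "unique_minimizer F \<theta> \<longleftrightarrow> {\<theta>'. is_arg_min F (\<lambda>_. True) \<theta>'} = {\<theta>}"

definition min_over :: "('a \<Rightarrow> real) \<Rightarrow> 'a set \<Rightarrow> real" where
  "min_over f A = (LEAST v. v \<in> f ` A)"

definition max_over :: "('a \<Rightarrow> real) \<Rightarrow> 'a set \<Rightarrow> real" where
  "max_over f A = (GREATEST v. v \<in> f ` A)"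

definition margin :: "('x \<Rightarrow> 'h::real_inner) \<Rightarrow> 'x \<Rightarrow> real \<Rightarrow> 'h \<Rightarrow> real" where
  "margin \<phi> x y \<theta> = y * (\<theta> \<bullet> \<phi> x)"

definition test_error ::
  "('x \<Rightarrow> 'h::real_inner) \<Rightarrow> nat \<Rightarrow> (nat \<Rightarrow> 'x) \<Rightarrow> (nat \<Rightarrow> real) \<Rightarrow> 'h \<Rightarrow> real" where
  "test_error \<phi> n x y \<theta> =
     1 / real n * (\<Sum>i=1..n. of_bool (y i \<noteq> sgn (model \<phi> \<theta> (x i))))"

definition n_cor ::
  "('x \<Rightarrow> 'h::real_inner) \<Rightarrow> nat \<Rightarrow> (nat \<Rightarrow> 'x) \<Rightarrow> (nat \<Rightarrow> real) \<Rightarrow> 'h set \<Rightarrow> nat" where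
  "n_cor \<phi> n x y \<Theta> = (\<Sum>i=1..n. of_bool (min_over (margin \<phi> (x i) (y i)) \<Theta> > 0))"

definition n_mis ::
  "('x \<Rightarrow> 'h::real_inner) \<Rightarrow> nat \<Rightarrow> (nat \<Rightarrow> 'x) \<Rightarrow> (nat \<Rightarrow> real) \<Rightarrow> 'h set \<Rightarrow> nat" where
  "n_mis \<phi> n x y \<Theta> = (\<Sum>i=1..n. of_bool (max_over (margin \<phi> (x i) (y i)) \<Theta> < 0))"

text \<open>
  Both inequalities are strict, so a point whose minimal or maximal margin is exactly
  \<open>0\<close> is counted neither here nor in \<^const>\<open>n_cor\<close> nor in \<^const>\<open>n_mis\<close>
  (for instance, a point with \<open>\<phi> x = 0\<close>).
\<close>

definition n_unk ::
  "('x \<Rightarrow> 'h::real_inner) \<Rightarrow> nat \<Rightarrow> (nat \<Rightarrow> 'x) \<Rightarrow> (nat \<Rightarrow> real) \<Rightarrow> 'h set \<Rightarrow> nat" where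
  "n_unk \<phi> n x y \<Theta> =
     (\<Sum>i=1..n. of_bool (min_over (margin \<phi> (x i) (y i)) \<Theta> < 0 \<and>
                        max_over (margin \<phi> (x i) (y i)) \<Theta> > 0))"

end

theory Submission
  imports Defs
begin

text \<open>
  Zero is a subgradient of the strongly convex \<open>P\<^sub>S\<close> at its minimizer, so the squared
  distance from \<open>\<theta>\<^sub>O\<close> to \<open>\<theta>\<^sub>S\<close> is at most \<open>2/\<lambda>\<close> times \<open>P\<^sub>S(\<theta>\<^sub>O) - P\<^sub>S(\<theta>\<^sub>S)\<close>. By strong
  duality \<open>P\<^sub>S(\<theta>\<^sub>S)\<close> bounds the dual objective from above, so this suboptimality is at most
  the duality gap and the ball \<open>\<Theta>\<close> contains \<open>\<theta>\<^sub>S\<close>. The margin is a linear functional,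
  whose extrema on a ball are attained in the direction of its Riesz representer.
\<close>

lemma strongly_convex_minimizer_dist:
  assumes "strongly_convex lam F" and "unique_minimizer F \<theta>'"
  shows "lam / 2 * (norm (\<theta> - \<theta>'))\<^sup>2 \<le> F \<theta> - F \<theta>'"
proof -
  have "is_arg_min F (\<lambda>_. True) \<theta>'"
    using assms(2) unfolding unique_minimizer_def by blast
  then have "0 \<in> subdifferential F \<theta>'"
    by (auto simp: subdifferential_def is_arg_min_def not_less)
  then have "F \<theta> - F \<theta>' \<ge> 0 \<bullet> (\<theta> - \<theta>') + lam / 2 * (norm (\<theta> - \<theta>'))\<^sup>2"
    using assms(1) unfolding strongly_convex_def by blast
  then show ?thesis by simp
qed

text \<open>\<open>min_over\<close> is a \<open>LEAST\<close>, whose value is determined only when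
  the minimum is attained; hence the demand for a witness instead of a mere lower bound.\<close>

lemma min_over_eqI:
  assumes "is_arg_min f (\<lambda>x. x \<in> A) a"
  shows "min_over f A = f a"
  unfolding min_over_def
  using assms by (intro Least_equality) (auto simp: is_arg_min_def not_less)

lemma max_over_eqI:
  assumes "is_arg_max f (\<lambda>x. x \<in> A) a"
  shows "max_over f A = f a"
  unfolding max_over_def
  using assms by (intro Greatest_equality) (auto simp: is_arg_max_def not_less)

text \<open>Cauchy-Schwarz for \<open>\<theta> - c\<close> against \<open>v\<close>. It serves both
  the optimality of the extremal points and the bounds on the margin of
  \<open>\<theta>S\<close>.\<close>

lemma inner_ge_on_ball:
  fixes v :: "'a::real_inner"
  assumes "norm (\<theta> - c) \<le> r"
  shows "c \<bullet> v - norm v * r \<le> \<theta> \<bullet> v"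
proof -
  have "\<bar>(\<theta> - c) \<bullet> v\<bar> \<le> norm (\<theta> - c) * norm v"
    by (rule Cauchy_Schwarz_ineq2)
  also have "\<dots> \<le> norm v * r"
    using mult_left_mono[OF assms norm_ge_zero[of v]] by (simp add: mult.commute)
  finally show ?thesis
    by (simp add: inner_diff_left)
qed

lemma inner_le_on_ball:
  fixes v :: "'a::real_inner"
  assumes "norm (\<theta> - c) \<le> r"
  shows "\<theta> \<bullet> v \<le> c \<bullet> v + norm v * r"
  using inner_ge_on_ball[OF assms, of "- v"] by simp

text \<open>For \<open>v = 0\<close> the junk value \<open>sgn 0 = 0\<close> makes the centre the witness.\<close>

lemma is_arg_min_inner_ball:
  fixes v :: "'a::real_inner"
  assumes "0 \<le> r"
  shows "is_arg_min (\<lambda>\<theta>. \<theta> \<bullet> v) (\<lambda>\<theta>. \<theta> \<in> {\<theta>. norm (\<theta> - c) \<le> r}) (c - r *\<^sub>R sgn v)"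
    and "(c - r *\<^sub>R sgn v) \<bullet> v = c \<bullet> v - norm v * r"
proof -
  have "sgn v \<bullet> v = norm v"
    by (cases "v = 0") (simp_all add: sgn_div_norm dot_square_norm power2_eq_square)
  then show val: "(c - r *\<^sub>R sgn v) \<bullet> v = c \<bullet> v - norm v * r"
    by (simp add: inner_diff_left)
  show "is_arg_min (\<lambda>\<theta>. \<theta> \<bullet> v) (\<lambda>\<theta>. \<theta> \<in> {\<theta>. norm (\<theta> - c) \<le> r}) (c - r *\<^sub>R sgn v)"
    \<comment> \<open>Membership of the witness uses \<open>0 \<le> r\<close>: its distance from
      \<open>c\<close> is \<open>r\<close>, or 0 if \<open>v = 0\<close>.\<close>
    unfolding is_arg_min_def val
    using assms inner_ge_on_ball[of _ c r v] by (auto simp: norm_sgn not_less)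
qed

text \<open>Maximizing against \<open>v\<close> is minimizing against \<open>- v\<close>, and
  \<open>sgn\<close> is odd.\<close>

lemma is_arg_max_inner_ball:
  fixes v :: "'a::real_inner"
  assumes "0 \<le> r"
  shows "is_arg_max (\<lambda>\<theta>. \<theta> \<bullet> v) (\<lambda>\<theta>. \<theta> \<in> {\<theta>. norm (\<theta> - c) \<le> r}) (c + r *\<^sub>R sgn v)"
    and "(c + r *\<^sub>R sgn v) \<bullet> v = c \<bullet> v + norm v * r"
  using is_arg_min_inner_ball[OF assms, where v = "- v" and c = c]
  by (simp_all add: is_arg_min_def is_arg_max_def sgn_minus)

text \<open>Absorbing the label into the vector brings the margin under the ball lemmas.\<close>

lemma margin_eq_inner: "margin \<phi> x y = (\<lambda>\<theta>. \<theta> \<bullet> (y *\<^sub>R \<phi> x))"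
  by (simp add: margin_def fun_eq_iff)

text \<open>The inequality is strict because \<open>sgn 0 = 0\<close> differs from both labels: a
  zero prediction is an error.\<close>

lemma label_eq_sgn_iff:
  fixes y t :: real
  assumes "y \<in> {-1, 1}"
  shows "y = sgn t \<longleftrightarrow> 0 < y * t"
  using assms by (auto simp: sgn_if)

text \<open>Pointwise exactly one of the three indicators is 1. An index with a zero endpoint would
  be counted by none of them.\<close>

lemma sum_of_bool_sign_cases:
  fixes lo hi :: "nat \<Rightarrow> real"
  assumes "\<And>i. i \<in> {1..n} \<Longrightarrow> lo i \<le> hi i"
    and "\<And>i. i \<in> {1..n} \<Longrightarrow> lo i \<noteq> 0 \<and> hi i \<noteq> 0"
  shows "(\<Sum>i=1..n. of_bool (hi i < 0)) + (\<Sum>i=1..n. of_bool (lo i < 0 \<and> 0 < hi i))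
    + (\<Sum>i=1..n. of_bool (0 < lo i)) = n"
proof -
  have "of_bool (hi i < 0) + of_bool (lo i < 0 \<and> 0 < hi i) + of_bool (0 < lo i) = (1::nat)"
    if "i \<in> {1..n}" for i
    using assms[OF that] by (auto simp: of_bool_def)
  then have "(\<Sum>i=1..n. of_bool (hi i < 0) + of_bool (lo i < 0 \<and> 0 < hi i) + of_bool (0 < lo i))
    = (\<Sum>i=1..n. 1::nat)"
    by (intro sum.cong refl)
  then show ?thesis
    by (simp only: sum.distrib) simp
qed

text \<open>The bound through \<open>n_cor\<close> is unconditional. The one through
  \<open>n_unk\<close> presupposes nonzero extrema: a test point with zero feature vector is an
  error that neither \<open>n_mis\<close> nor \<open>n_unk\<close> counts.\<close>

theorem lemma3p4:
  fixes \<phi> :: "real ^ 'd \<Rightarrow> 'h::{real_inner, complete_space}"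
    and loss :: "real \<Rightarrow> real \<Rightarrow> real"
    and lam :: real
    and nO nS n' :: nat
    and xO xS x' :: "nat \<Rightarrow> real ^ 'd"
    and yO yS y' :: "nat \<Rightarrow> real"
    and \<theta>O \<theta>S :: 'h
    and \<alpha>S \<alpha> :: "nat \<Rightarrow> real"
    and G :: real
    and \<Theta> :: "'h set"
  assumes lambda_pos: "lam > 0"
    and loss_convex: "\<And>y. convex_on UNIV (loss y)"
    and loss_continuous: "\<And>y. continuous_on UNIV (loss y)"
    and labels_O: "\<And>i. i \<in> {1..nO} \<Longrightarrow> yO i \<in> {-1, 1}"
    and strongly_convex_O: "strongly_convex lam (primal loss \<phi> lam nO xO yO)"
    and strongly_convex_S: "strongly_convex lam (primal loss \<phi> lam nS xS yS)"
    and minimizer_O: "unique_minimizer (primal loss \<phi> lam nO xO yO) \<theta>O"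
    and minimizer_S: "unique_minimizer (primal loss \<phi> lam nS xS yS) \<theta>S"
    and dual_maximizer: "is_arg_max (dual loss \<phi> lam nS xS yS) (\<lambda>_. True) \<alpha>S"
    and strong_duality: "ereal (primal loss \<phi> lam nS xS yS \<theta>S) = dual loss \<phi> lam nS xS yS \<alpha>S"
    and feasible: "\<alpha> \<in> dual_dom loss \<phi> lam nS xS yS"
    and G_eq: "G = duality_gap loss \<phi> lam nS xS yS \<theta>O \<alpha>"
    and Theta_eq: "\<Theta> = {\<theta>. norm (\<theta> - \<theta>O) \<le> sqrt (2 / lam * G)}"
    and test_nonempty: "n' > 0"
    and labels_test: "\<And>i. i \<in> {1..n'} \<Longrightarrow> y' i \<in> {-1, 1}"
  shows
    "real (n_mis \<phi> n' x' y' \<Theta>) / real n' \<le> test_error \<phi> n' x' y' \<theta>S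
     \<and> test_error \<phi> n' x' y' \<theta>S \<le> (real n' - real (n_cor \<phi> n' x' y' \<Theta>)) / real n'
     \<and> ((\<forall>i\<in>{1..n'}. min_over (margin \<phi> (x' i) (y' i)) \<Theta> \<noteq> 0 \<and>
                      max_over (margin \<phi> (x' i) (y' i)) \<Theta> \<noteq> 0)
        \<longrightarrow> test_error \<phi> n' x' y' \<theta>S
              \<le> (real (n_mis \<phi> n' x' y' \<Theta>) + real (n_unk \<phi> n' x' y' \<Theta>)) / real n'
          \<and> (real (n_mis \<phi> n' x' y' \<Theta>) + real (n_unk \<phi> n' x' y' \<Theta>)) / real n'
              = (real n' - real (n_cor \<phi> n' x' y' \<Theta>)) / real n')
     \<and> (\<forall>i\<in>{1..n'}.
          (\<exists>\<theta>. is_arg_min (margin \<phi> (x' i) (y' i)) (\<lambda>\<theta>. \<theta> \<in> \<Theta>) \<theta>)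
        \<and> min_over (margin \<phi> (x' i) (y' i)) \<Theta>
            = y' i * (\<theta>O \<bullet> \<phi> (x' i)) - norm (\<phi> (x' i)) * sqrt (2 / lam * G)
        \<and> y' i * (\<theta>O \<bullet> \<phi> (x' i)) - norm (\<phi> (x' i)) * sqrt (2 / lam * G)
            = y' i * model \<phi> \<theta>O (x' i) - sqrt (kernel \<phi> (x' i) (x' i) * (2 / lam * G))
        \<and> (\<exists>\<theta>. is_arg_max (margin \<phi> (x' i) (y' i)) (\<lambda>\<theta>. \<theta> \<in> \<Theta>) \<theta>)
        \<and> max_over (margin \<phi> (x' i) (y' i)) \<Theta>
            = y' i * model \<phi> \<theta>O (x' i) + sqrt (kernel \<phi> (x' i) (x' i) * (2 / lam * G)))"
proof -
  let ?P = "primal loss \<phi> lam nS xS yS"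
  let ?D = "dual loss \<phi> lam nS xS yS"
  let ?lo = "\<lambda>i. min_over (margin \<phi> (x' i) (y' i)) \<Theta>"
  let ?hi = "\<lambda>i. max_over (margin \<phi> (x' i) (y' i)) \<Theta>"
  let ?wrong = "\<lambda>i. y' i \<noteq> sgn (model \<phi> \<theta>S (x' i))"
  define r where "r = sqrt (2 / lam * G)"

  have "?D \<alpha> \<le> ereal (?P \<theta>S)"
    using dual_maximizer strong_duality by (simp add: is_arg_max_def not_less)
  \<comment> \<open>With both infinities excluded, \<open>real_of_ereal\<close> returns the true
    dual value and not its default 0.\<close>
  moreover have "?D \<alpha> \<noteq> -\<infinity>"
    using feasible by (simp add: dual_dom_def)
  ultimately have "real_of_ereal (?D \<alpha>) \<le> ?P \<theta>S"
    by (cases "?D \<alpha>") auto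
  then have "?P \<theta>O - ?P \<theta>S \<le> G"
    by (simp add: G_eq duality_gap_def)
  with strongly_convex_minimizer_dist[OF strongly_convex_S minimizer_S, of \<theta>O]
  have "lam / 2 * (norm (\<theta>O - \<theta>S))\<^sup>2 \<le> G"
    by linarith
  then have dist: "(norm (\<theta>S - \<theta>O))\<^sup>2 \<le> 2 / lam * G"
    using lambda_pos by (simp add: field_simps norm_minus_commute)
  \<comment> \<open>In HOL the \<open>sqrt\<close> of a negative number is negative, so the radius
    must be shown to be nonnegative.\<close>
  then have "0 \<le> 2 / lam * G"
    by (rule order_trans[OF zero_le_power2])
  then have r_nonneg: "0 \<le> r"
    by (simp add: r_def)
  have \<theta>S_in: "\<theta>S \<in> \<Theta>"
    using dist by (simp add: Theta_eq real_le_rsqrt)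
  have ball: "\<Theta> = {\<theta>. norm (\<theta> - \<theta>O) \<le> r}"
    by (simp add: Theta_eq r_def)

  have extrema:
    "(\<exists>\<theta>. is_arg_min (margin \<phi> (x' i) (y' i)) (\<lambda>\<theta>. \<theta> \<in> \<Theta>) \<theta>)"
    "?lo i = y' i * (\<theta>O \<bullet> \<phi> (x' i)) - norm (\<phi> (x' i)) * r"
    "(\<exists>\<theta>. is_arg_max (margin \<phi> (x' i) (y' i)) (\<lambda>\<theta>. \<theta> \<in> \<Theta>) \<theta>)"
    "?hi i = y' i * (\<theta>O \<bullet> \<phi> (x' i)) + norm (\<phi> (x' i)) * r"
    if "i \<in> {1..n'}" for i
  proof -
    let ?v = "y' i *\<^sub>R \<phi> (x' i)"
    have nv: "norm ?v = norm (\<phi> (x' i))"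
      using labels_test[OF that] by auto
    note mins = is_arg_min_inner_ball[OF r_nonneg, where v = ?v and c = \<theta>O, folded ball]
    note maxs = is_arg_max_inner_ball[OF r_nonneg, where v = ?v and c = \<theta>O, folded ball]
    show "\<exists>\<theta>. is_arg_min (margin \<phi> (x' i) (y' i)) (\<lambda>\<theta>. \<theta> \<in> \<Theta>) \<theta>"
      using mins(1) unfolding margin_eq_inner by blast
    show "\<exists>\<theta>. is_arg_max (margin \<phi> (x' i) (y' i)) (\<lambda>\<theta>. \<theta> \<in> \<Theta>) \<theta>"
      using maxs(1) unfolding margin_eq_inner by blast
    show "?lo i = y' i * (\<theta>O \<bullet> \<phi> (x' i)) - norm (\<phi> (x' i)) * r"
      unfolding margin_eq_inner min_over_eqI[OF mins(1)] mins(2) nv by simp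
    show "?hi i = y' i * (\<theta>O \<bullet> \<phi> (x' i)) + norm (\<phi> (x' i)) * r"
      unfolding margin_eq_inner max_over_eqI[OF maxs(1)] maxs(2) nv by simp
  qed

  \<comment> \<open>As \<open>\<theta>S\<close> lies in the ball, its margin is trapped between the
    two extrema.\<close>
  have between: "?lo i \<le> y' i * model \<phi> \<theta>S (x' i)" "y' i * model \<phi> \<theta>S (x' i) \<le> ?hi i"
    if "i \<in> {1..n'}" for i
  proof -
    have in_ball: "norm (\<theta>S - \<theta>O) \<le> r"
      using \<theta>S_in by (simp add: ball)
    have "\<bar>y' i\<bar> = 1"
      using labels_test[OF that] by auto
    then show "?lo i \<le> y' i * model \<phi> \<theta>S (x' i)" "y' i * model \<phi> \<theta>S (x' i) \<le> ?hi i"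
      using inner_ge_on_ball[OF in_ball, of "y' i *\<^sub>R \<phi> (x' i)"]
        inner_le_on_ball[OF in_ball, of "y' i *\<^sub>R \<phi> (x' i)"]
      unfolding extrema(2,4)[OF that] by (simp_all add: model_def inner_commute)
  qed

  have wrong: "?wrong i \<longleftrightarrow> y' i * model \<phi> \<theta>S (x' i) \<le> 0" if "i \<in> {1..n'}" for i
    using label_eq_sgn_iff[OF labels_test[OF that]] by (simp add: not_less)

  have error: "test_error \<phi> n' x' y' \<theta>S = (\<Sum>i=1..n'. of_bool (?wrong i)) / real n'"
    by (simp add: test_error_def)

  \<comment> \<open>A negative maximum forces the margin of \<open>\<theta>S\<close> to be negative,
    hence an error.\<close>
  have "real (n_mis \<phi> n' x' y' \<Theta>) \<le> (\<Sum>i=1..n'. of_bool (?wrong i))"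
    unfolding n_mis_def of_nat_sum of_nat_of_bool
    using between(2) wrong by (intro sum_mono) (fastforce simp: of_bool_def)
  then have lower: "real (n_mis \<phi> n' x' y' \<Theta>) / real n' \<le> test_error \<phi> n' x' y' \<theta>S"
    unfolding error by (rule divide_right_mono) simp

  \<comment> \<open>At an error the margin of \<open>\<theta>S\<close> is at most 0, hence so is the
    minimum; a zero minimum does no harm here.\<close>
  have "(\<Sum>i=1..n'. of_bool (?wrong i)) \<le> (\<Sum>i=1..n'. 1 - of_bool (0 < ?lo i) :: real)"
    using between(1) wrong by (intro sum_mono) (fastforce simp: of_bool_def)
  also have "\<dots> = real n' - real (n_cor \<phi> n' x' y' \<Theta>)"
    by (simp add: n_cor_def sum_subtractf)
  finally have upper:
    "test_error \<phi> n' x' y' \<theta>S \<le> (real n' - real (n_cor \<phi> n' x' y' \<Theta>)) / real n'"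
    unfolding error by (rule divide_right_mono) simp

  have count: "real (n_mis \<phi> n' x' y' \<Theta>) + real (n_unk \<phi> n' x' y' \<Theta>)
      = real n' - real (n_cor \<phi> n' x' y' \<Theta>)"
    if "\<forall>i\<in>{1..n'}. ?lo i \<noteq> 0 \<and> ?hi i \<noteq> 0"
  proof -
    have "n_mis \<phi> n' x' y' \<Theta> + n_unk \<phi> n' x' y' \<Theta> + n_cor \<phi> n' x' y' \<Theta> = n'"
      unfolding n_mis_def n_unk_def n_cor_def
      \<comment> \<open>The margin of \<open>\<theta>S\<close> is the intermediate value giving
        \<open>?lo i \<le> ?hi i\<close>.\<close>
      using that order_trans[OF between] by (intro sum_of_bool_sign_cases) auto
    then show ?thesis
      by linarith
  qed

  \<comment> \<open>The diagonal of the kernel is the squared feature norm, and \<open>sqrt\<close>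
    is multiplicative on all reals.\<close>
  have radius: "sqrt (kernel \<phi> (x' i) (x' i) * (2 / lam * G)) = norm (\<phi> (x' i)) * r" for i
    by (simp only: kernel_def r_def real_sqrt_mult norm_eq_sqrt_inner)
  show ?thesis
    unfolding radius r_def[symmetric]
    using lower upper count extrema by (simp add: model_def inner_commute)
qed

end
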